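(* Given $\mu>0$, let $f:\mathbb{R}\to\mathbb{R}$ be a measurable function such that $$\int_{\mathbb{R}}dy\,e^{-\mu\cosh y}\,|f(\sinh y)|<\infty.$$ Then $$\int_{\mathbb{R}}dy\,e^{-\mu\cosh y}f(\sinh y)=\int_0^\infty\frac{dv}{v}\,\exp\left(-\frac{1}{2v}\right)\exp\left(-\frac{\mu^2}{2}v\right)\mathbb{E}\left[f(\beta(v))\right],$$ where $\beta=\{\beta(t)\}_{t\ge0}$ is a Brownian motion.
   Context: Brownian motion means one-dimensional standard Brownian motion started at $0$; $\mathbb{E}$ denotes expectation. *)

theory Defs
  imports "HOL-Probability.Probability"
begin

text \<open>
  One-dimensional standard Brownian motion started at \<open>0\<close>. Only the values of \<open>B\<close> at times
  \<open>t \<ge> 0\<close> are constrained. Starting point and path continuity are required almost surely, which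
  includes the convention that they hold for every outcome. The second parameter of
  \<^const>\<open>normal_density\<close> is the standard deviation.
\<close>

locale standard_brownian_motion = prob_space M
  for M :: "'a measure" and B :: "real \<Rightarrow> 'a \<Rightarrow> real" +
  assumes measurable_B: "\<And>t. 0 \<le> t \<Longrightarrow> random_variable borel (B t)"
    and starts_at_0: "AE \<omega> in M. B 0 \<omega> = 0"
    and indep_increments:
      "\<And>(n::nat) (t :: nat \<Rightarrow> real). 0 \<le> t 0 \<Longrightarrow> strict_mono_on {..n} t \<Longrightarrow>
         indep_vars (\<lambda>_. borel) (\<lambda>i \<omega>. B (t (Suc i)) \<omega> - B (t i) \<omega>) {..<n}"
    and normal_increments:
      "\<And>s t. 0 \<le> s \<Longrightarrow> s < t \<Longrightarrow>
         distributed M lborel (\<lambda>\<omega>. B t \<omega> - B s \<omega>) (normal_density 0 (sqrt (t - s)))"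
    and continuous_paths: "AE \<omega> in M. continuous_on {0..} (\<lambda>t. B t \<omega>)"

end

theory Submission
  imports Defs "HOL-Real_Asymp.Real_Asymp"
begin

text \<open>
  Write \<open>s = sqrt (1 + x\<^sup>2)\<close>. Inserting the normal density of \<open>\<beta> v\<close> and integrating over \<open>v\<close> first,
  the coefficient of \<open>f x\<close> on the right-hand side is the integral of
  \<open>exp (- s\<^sup>2 / (2 * v) - \<mu>\<^sup>2 * v / 2) / (v * sqrt (2 * pi * v))\<close>, an inverse Gaussian integral with
  value \<open>exp (- \<mu> * s) / s\<close>. The substitution \<open>x = sinh y\<close> turns \<open>s\<close> into \<open>cosh y\<close>.
\<close>

text \<open>Near \<open>x\<close> the distribution function is a constant plus the integral of a
  continuous density, so the fundamental theorem of calculus applies.\<close>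

lemma std_normal_cdf_has_real_derivative:
  "(cdf std_normal_distribution has_real_derivative std_normal_density x) (at x)"
proof -
  interpret real_distribution std_normal_distribution
    by (rule real_dist_normal_dist)
  \<comment> \<open>\<open>x\<close> is interior to \<open>{a..b}\<close>, so a derivative within
    this interval is a full derivative.\<close>
  define a b where "a = x - 1" and "b = x + 1"
  have eq: "cdf std_normal_distribution a + (LBINT y=a..u. std_normal_density y)
              = cdf std_normal_distribution u" if "u \<in> {a..b}" for u
  proof (cases "a < u")
    case True
    have "measure std_normal_distribution {a<..u} = (LINT y|std_normal_distribution. indicator {a<..u} y)"
      by simp
    also have "\<dots> = (LINT y|lborel. std_normal_density y * indicator {a<..u} y)"
      by (subst integral_real_density) auto
    also have "\<dots> = (LBINT y=a..u. std_normal_density y)"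
      using True by (simp add: interval_integral_Ioc set_lebesgue_integral_def mult.commute)
    finally show ?thesis
      using cdf_diff_eq[OF True] by simp
  qed (use that in \<open>simp add: interval_integral_endpoints_same\<close>)
  have "continuous_on {a..b} std_normal_density"
    unfolding std_normal_density_def by (intro continuous_intros) auto
  from interval_integral_FTC2[of a a b, OF _ _ this, of x]
  have "((\<lambda>u. LBINT y=a..u. std_normal_density y) has_real_derivative std_normal_density x)
          (at x within {a..b})"
    by (simp add: has_real_derivative_iff_has_vector_derivative a_def b_def)
  then have "((\<lambda>u. cdf std_normal_distribution a + (LBINT y=a..u. std_normal_density y))
          has_real_derivative std_normal_density x) (at x within {a..b})"
    by (auto intro!: derivative_eq_intros)
  then have "(cdf std_normal_distribution has_real_derivative std_normal_density x) (at x within {a..b})"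
    by (rule has_field_derivative_transform_within[where d = 1]) (use eq in \<open>auto simp: a_def b_def\<close>)
  then show ?thesis
    by (subst (asm) at_within_Icc_at) (auto simp: a_def b_def)
qed

text \<open>
  The antiderivative is, up to the factor \<open>exp (- (a * \<mu>)) / a\<close>, the distribution function of
  the first time at which a Brownian motion with drift \<open>\<mu>\<close> hits the level \<open>a\<close>.
\<close>

lemma inverse_gaussian_integral:
  fixes a \<mu> :: real
  assumes a: "a > 0" and \<mu>: "\<mu> > 0"
  defines "h \<equiv> \<lambda>v. exp (- a\<^sup>2 / (2 * v)) * exp (- (\<mu>\<^sup>2 / 2) * v) / (v * sqrt (2 * pi * v))"
  shows "set_integrable lborel {0<..} h"
    and "(LBINT v:{0<..}. h v) = exp (- \<mu> * a) / a"
proof -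
  interpret real_distribution std_normal_distribution
    by (rule real_dist_normal_dist)
  let ?\<Phi> = "cdf std_normal_distribution"
  \<comment> \<open>The squares of \<open>p v\<close> and \<open>q v\<close> differ only in the sign
    of the cross term \<open>2 * \<mu> * a\<close>; the factors \<open>exp (- \<mu> * a)\<close> and
    \<open>exp (\<mu> * a)\<close> in \<open>G\<close> compensate for it.\<close>
  define p q where "p = (\<lambda>v. \<mu> * sqrt v - a / sqrt v)" and "q = (\<lambda>v. - (\<mu> * sqrt v) - a / sqrt v)"
  define G where "G = (\<lambda>v. (exp (- \<mu> * a) * ?\<Phi> (p v) + exp (\<mu> * a) * ?\<Phi> (q v)) / a)"
  have p: "(p has_real_derivative (\<mu> / (2 * sqrt v) + a / (2 * v * sqrt v))) (at v)"
    and q: "(q has_real_derivative (- \<mu> / (2 * sqrt v) + a / (2 * v * sqrt v))) (at v)"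
    if "v > 0" for v
    unfolding p_def q_def using that
    by (auto intro!: derivative_eq_intros simp: field_simps)
  have deriv: "(G has_real_derivative h v) (at v)" if v: "v > 0" for v
  proof -
    \<comment> \<open>\<open>E\<close> is the common value of both weighted densities, so the terms
      \<open>\<mu> / (2 * sqrt v)\<close> cancel in the derivative of \<open>G\<close> and the two
      others add up.\<close>
    define E where "E = exp (- a\<^sup>2 / (2 * v)) * exp (- (\<mu>\<^sup>2 / 2) * v) / sqrt (2 * pi)"
    have "(p v)\<^sup>2 = \<mu>\<^sup>2 * v - 2 * \<mu> * a + a\<^sup>2 / v" "(q v)\<^sup>2 = \<mu>\<^sup>2 * v + 2 * \<mu> * a + a\<^sup>2 / v"
      using v by (simp_all add: p_def q_def power2_diff power_mult_distrib power_divide)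
    then have P: "exp (- \<mu> * a) * std_normal_density (p v) = E"
      and Q: "exp (\<mu> * a) * std_normal_density (q v) = E"
      by (simp_all add: std_normal_density_def E_def exp_add[symmetric] field_simps add_divide_distrib)
    have "(G has_real_derivative
            (exp (- \<mu> * a) * (std_normal_density (p v) * (\<mu> / (2 * sqrt v) + a / (2 * v * sqrt v)))
             + exp (\<mu> * a) * (std_normal_density (q v) * (- \<mu> / (2 * sqrt v) + a / (2 * v * sqrt v)))) / a)
            (at v)"
      unfolding G_def
      by (intro DERIV_cdivide DERIV_add DERIV_cmult
          DERIV_chain2[OF std_normal_cdf_has_real_derivative] p q v)
    also have "(exp (- \<mu> * a) * (std_normal_density (p v) * (\<mu> / (2 * sqrt v) + a / (2 * v * sqrt v)))
             + exp (\<mu> * a) * (std_normal_density (q v) * (- \<mu> / (2 * sqrt v) + a / (2 * v * sqrt v)))) / a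
           = (E * (\<mu> / (2 * sqrt v) + a / (2 * v * sqrt v))
             + E * (- \<mu> / (2 * sqrt v) + a / (2 * v * sqrt v))) / a"
      unfolding mult.assoc[symmetric] P Q ..
    also have "\<dots> = E / (v * sqrt v)"
      using a v by (simp add: field_simps)
    also have "\<dots> = h v"
      using v by (simp add: E_def h_def real_sqrt_mult)
    finally show ?thesis .
  qed
  have cont: "isCont h v" if "v > 0" for v
    unfolding h_def using that by (intro continuous_intros) auto
  \<comment> \<open>At 0 both arguments tend to minus infinity and \<open>G\<close> vanishes; at
    infinity \<open>p\<close> changes sides, so only the first summand of \<open>G\<close>
    survives.\<close>
  have "filterlim p at_bot (at_right 0)" "filterlim q at_bot (at_right 0)"
    unfolding p_def q_def using a \<mu> by real_asymp+
  from this[THEN filterlim_compose[OF cdf_lim_at_bot]]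
  have "(G \<longlongrightarrow> (exp (- \<mu> * a) * 0 + exp (\<mu> * a) * 0) / a) (at_right 0)"
    unfolding G_def using a by (intro tendsto_intros) auto
  then have lim0: "((G \<circ> real_of_ereal) \<longlongrightarrow> 0) (at_right (ereal 0))"
    by (simp add: ereal_tendsto_simps)
  have "filterlim p at_top at_top" "filterlim q at_bot at_top"
    unfolding p_def q_def using a \<mu> by real_asymp+
  then have "(G \<longlongrightarrow> (exp (- \<mu> * a) * 1 + exp (\<mu> * a) * 0) / a) at_top"
    unfolding G_def using a
    by (intro tendsto_intros filterlim_compose[OF cdf_lim_at_top_prob] filterlim_compose[OF cdf_lim_at_bot]) auto
  then have lim1: "((G \<circ> real_of_ereal) \<longlongrightarrow> exp (- \<mu> * a) / a) (at_left \<infinity>)"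
    by (simp add: ereal_tendsto_simps)
  have nn: "h v \<ge> 0" if "v > 0" for v
    using that by (simp add: h_def)
  \<comment> \<open>As \<open>h\<close> is nonnegative, finite limits of \<open>G\<close> at both
    ends yield integrability together with the value.\<close>
  note FTC = interval_integral_FTC_nonneg[of "ereal 0" \<infinity> G h, OF _ _ _ _ lim0 lim1]
  show "set_integrable lborel {0<..} h"
    using FTC(1) deriv cont nn by simp
  show "(LBINT v:{0<..}. h v) = exp (- \<mu> * a) / a"
    using FTC(2) deriv cont nn by (simp add: interval_lebesgue_integral_def)
qed

text \<open>The map \<open>sinh\<close> is a bijection of the real line with derivative
  \<open>cosh\<close>, which is positive. The change of variables holds for Lebesgue measurable
  functions; Borel measurability of \<open>F\<close> brings the result back to
  \<open>lborel\<close>.\<close>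

lemma
  fixes F :: "real \<Rightarrow> real"
  assumes [measurable]: "F \<in> borel_measurable borel"
    and int: "integrable lborel (\<lambda>y. cosh y * F (sinh y))"
  shows integrable_sinh_substitution: "integrable lborel F"
    and integral_sinh_substitution: "(LBINT y. cosh y * F (sinh y)) = (LBINT x. F x)"
proof -
  have surj: "range (sinh :: real \<Rightarrow> real) = UNIV"
    by (metis surjI sinh_arsinh_real)
  have inj: "inj (sinh :: real \<Rightarrow> real)"
    by (rule injI) simp
  \<comment> \<open>Since \<open>b\<close> is arbitrary, taking the left integral for
    \<open>b\<close> gives both integrability and equality of the integrals.\<close>
  have "(\<lambda>y. \<bar>cosh y\<bar> * F (sinh y)) absolutely_integrable_on UNIV
          \<and> integral UNIV (\<lambda>y. \<bar>cosh y\<bar> * F (sinh y)) = b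
        \<longleftrightarrow> F absolutely_integrable_on range sinh \<and> integral (range sinh) F = b" for b
    by (rule has_absolute_integral_change_of_variables_1'[OF _ _ inj])
       (auto intro!: derivative_eq_intros)
  moreover have "(\<lambda>y. cosh y * F (sinh y)) absolutely_integrable_on UNIV"
    using int by (simp add: set_integrable_def integrable_completion)
  ultimately have *: "F absolutely_integrable_on UNIV"
      "integral UNIV F = integral UNIV (\<lambda>y. cosh y * F (sinh y))"
    by (auto simp: surj)
  then show "integrable lborel F"
    by (simp add: set_integrable_def integrable_completion)
  with * int show "(LBINT y. cosh y * F (sinh y)) = (LBINT x. F x)"
    by (simp add: integral_lborel)
qed

text \<open>\<open>B v\<close> agrees almost surely with its increment from time 0, hence has the
  same law.\<close>

lemma (in standard_brownian_motion) distributed_normal: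
  assumes "v > 0"
  shows "distributed M lborel (B v) (normal_density 0 (sqrt v))"
proof -
  have "distr M lborel (B v) = distr M lborel (\<lambda>\<omega>. B v \<omega> - B 0 \<omega>)"
    using starts_at_0 measurable_B[of v] measurable_B[of 0] assms
    by (intro distr_cong_AE) (auto elim!: eventually_mono)
  then show ?thesis
    using normal_increments[of 0 v] measurable_B[of v] assms by (simp add: distributed_def)
qed

text \<open>For fixed \<open>v\<close> the Gaussian decays faster than
  \<open>exp (- \<mu> * s) / s\<close>. Using \<open>\<mu> + 1\<close> in place of
  \<open>\<mu>\<close> gains a factor \<open>exp (- s)\<close>, which is at most
  \<open>1 / s\<close>.\<close>

lemma normal_density_le_exp_sqrt:
  fixes \<mu> v x :: real
  assumes "v > 0"
  defines "s \<equiv> sqrt (1 + x\<^sup>2)"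
  shows "normal_density 0 (sqrt v) x
           \<le> exp ((\<mu> + 1)\<^sup>2 * v / 2 + 1 / (2 * v)) / sqrt (2 * pi * v) * (exp (- \<mu> * s) / s)"
proof -
  have s: "s > 0" "x\<^sup>2 = s\<^sup>2 - 1"
    by (simp_all add: s_def add_pos_nonneg)
  \<comment> \<open>Expanding this square and inserting \<open>s\<^sup>2 = 1 + x\<^sup>2\<close>
    compares the two exponents.\<close>
  have "0 \<le> ((\<mu> + 1) * v - s)\<^sup>2 / (2 * v)"
    using assms by simp
  also have "\<dots> = ((\<mu> + 1)\<^sup>2 * v / 2 + 1 / (2 * v) - \<mu> * s) - (s - x\<^sup>2 / (2 * v))"
    using assms s by (simp add: field_simps power2_eq_square)
  finally have "exp s * exp (- (x\<^sup>2 / (2 * v))) \<le> exp ((\<mu> + 1)\<^sup>2 * v / 2 + 1 / (2 * v)) * exp (- \<mu> * s)"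
    by (simp add: exp_add[symmetric])
  moreover have "s \<le> exp s"
    using exp_ge_add_one_self[of s] by linarith
  ultimately have "s * exp (- (x\<^sup>2 / (2 * v))) \<le> exp ((\<mu> + 1)\<^sup>2 * v / 2 + 1 / (2 * v)) * exp (- \<mu> * s)"
    by (meson exp_ge_zero mult_right_mono order_trans)
  then have "exp (- (x\<^sup>2 / (2 * v))) \<le> exp ((\<mu> + 1)\<^sup>2 * v / 2 + 1 / (2 * v)) * exp (- \<mu> * s) / s"
    using s(1) by (simp add: pos_le_divide_eq mult.commute)
  then have "exp (- (x\<^sup>2 / (2 * v))) / sqrt (2 * pi * v)
      \<le> exp ((\<mu> + 1)\<^sup>2 * v / 2 + 1 / (2 * v)) * exp (- \<mu> * s) / s / sqrt (2 * pi * v)"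
    using assms by (intro divide_right_mono) auto
  then show ?thesis
    using assms by (simp add: normal_density_def mult.commute)
qed

theorem proposition1p1:
  fixes \<mu> :: real and f :: "real \<Rightarrow> real"
    and M :: "'a measure" and \<beta> :: "real \<Rightarrow> 'a \<Rightarrow> real"
  assumes "\<mu> > 0"
    and "f \<in> borel_measurable borel"
    and "(\<integral>\<^sup>+ y. ennreal (exp (- \<mu> * cosh y) * \<bar>f (sinh y)\<bar>) \<partial>lborel) < \<infinity>"
    and "standard_brownian_motion M \<beta>"
  shows "(\<forall>v>0. integrable M (\<lambda>\<omega>. f (\<beta> v \<omega>)))
    \<and> set_integrable lborel {0<..}
        (\<lambda>v. (1 / v) * exp (- 1 / (2 * v)) * exp (- (\<mu>\<^sup>2 / 2) * v) * (LINT \<omega>|M. f (\<beta> v \<omega>)))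
    \<and> (LBINT y. exp (- \<mu> * cosh y) * f (sinh y)) =
      (LBINT v:{0<..}. (1 / v) * exp (- 1 / (2 * v)) * exp (- (\<mu>\<^sup>2 / 2) * v) * (LINT \<omega>|M. f (\<beta> v \<omega>)))"
proof -
  interpret standard_brownian_motion M \<beta> by fact
  note [measurable] = assms(2)
  define s :: "real \<Rightarrow> real" where "s = (\<lambda>x. sqrt (1 + x\<^sup>2))"
  have s_pos: "s x > 0" and s_sq: "(s x)\<^sup>2 = 1 + x\<^sup>2" for x
    by (simp_all add: s_def add_pos_nonneg)
  have s_sinh: "s (sinh y) = cosh y" for y
    unfolding s_def by (subst add.commute, subst cosh_square_eq[symmetric]) simp
  have [measurable]: "s \<in> borel_measurable borel"
    by (simp add: s_def)
  \<comment> \<open>\<open>F\<close> is where both sides meet: the Jacobian \<open>cosh y\<close>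
    cancels \<open>1 / s (sinh y)\<close>, and \<open>exp (- \<mu> * s x) / s x\<close> is the
    inverse Gaussian integral with \<open>a = s x\<close>.\<close>
  define F where "F = (\<lambda>x. exp (- \<mu> * s x) / s x * f x)"
  have [measurable]: "F \<in> borel_measurable borel"
    by (simp add: F_def)
  have F_sinh: "exp (- \<mu> * cosh y) * f (sinh y) = cosh y * F (sinh y)" for y
    by (simp add: F_def s_sinh)
  have [measurable]: "(sinh :: real \<Rightarrow> real) \<in> borel_measurable borel"
      "(cosh :: real \<Rightarrow> real) \<in> borel_measurable borel"
    by (intro borel_measurable_continuous_onI continuous_intros)+
  have int: "integrable lborel (\<lambda>y. cosh y * F (sinh y))"
    unfolding F_sinh[symmetric] using assms(3)
    by (intro integrableI_bounded) (simp_all add: abs_mult)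
  have F_int: "integrable lborel F"
    by (rule integrable_sinh_substitution[OF _ int]) simp
  have LHS: "(LBINT y. exp (- \<mu> * cosh y) * f (sinh y)) = (LBINT x. F x)"
    unfolding F_sinh by (rule integral_sinh_substitution[OF _ int]) simp
  note expect = distributed_integrable[OF distributed_normal, of _ f]
    distributed_integral[OF distributed_normal, of _ f]
  \<comment> \<open>Fubini would give this for almost every \<open>v\<close> only; the pointwise
    bound on the density gives it for each \<open>v > 0\<close>.\<close>
  have int_f: "integrable M (\<lambda>\<omega>. f (\<beta> v \<omega>))" if v: "v > 0" for v
  proof -
    define C where "C = exp ((\<mu> + 1)\<^sup>2 * v / 2 + 1 / (2 * v)) / sqrt (2 * pi * v)"
    have bound: "norm (normal_density 0 (sqrt v) x * f x) \<le> norm (C * F x)" for x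
    proof -
      have "normal_density 0 (sqrt v) x * \<bar>f x\<bar> \<le> C * (exp (- \<mu> * s x) / s x) * \<bar>f x\<bar>"
        using normal_density_le_exp_sqrt[OF v, of x \<mu>]
        by (intro mult_right_mono) (simp_all add: C_def s_def)
      moreover have "C > 0"
        using v by (simp add: C_def)
      ultimately show ?thesis
        using s_pos[of x] by (simp add: F_def abs_mult)
    qed
    have "integrable lborel (\<lambda>x. C * F x)"
      using F_int by simp
    then have "integrable lborel (\<lambda>x. normal_density 0 (sqrt v) x * f x)"
      by (rule Bochner_Integration.integrable_bound) (use bound in auto)
    then show ?thesis
      using expect(1)[OF v] by simp
  qed
  define w where "w = (\<lambda>v::real. (1 / v) * exp (- 1 / (2 * v)) * exp (- (\<mu>\<^sup>2 / 2) * v))"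
  \<comment> \<open>The indicator extends the kernel by 0, so that Fubini can be used on the whole
    plane.\<close>
  define k where "k = (\<lambda>x v. indicator {0<..} v * (w v * normal_density 0 (sqrt v) x))"
  have [measurable]: "case_prod k \<in> borel_measurable (lborel \<Otimes>\<^sub>M lborel)"
    unfolding k_def w_def normal_density_def by measurable
  have k_nonneg: "k x v \<ge> 0" for x v
    by (auto simp: k_def w_def indicator_def)
  have k_eq: "k x v = indicator {0<..} v *\<^sub>R
      (exp (- (s x)\<^sup>2 / (2 * v)) * exp (- (\<mu>\<^sup>2 / 2) * v) / (v * sqrt (2 * pi * v)))" for x v
    by (auto simp: k_def w_def normal_density_def s_sq indicator_def exp_add[symmetric]
        diff_divide_distrib add_divide_distrib)
  have k_int: "integrable lborel (k x)" and k_integral: "(LBINT v. k x v) = exp (- \<mu> * s x) / s x" for x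
    using inverse_gaussian_integral[OF s_pos assms(1), of x]
    unfolding set_integrable_def set_lebesgue_integral_def k_eq[symmetric] by simp_all
  \<comment> \<open>Because \<open>k\<close> is nonnegative, integrating the absolute value over
    \<open>v\<close> gives exactly \<open>\<bar>F x\<bar>\<close>, which is integrable.\<close>
  have kf_int: "integrable (lborel \<Otimes>\<^sub>M lborel) (\<lambda>(x, v). k x v * f x)"
  proof (rule lborel_pair.Fubini_integrable)
    have "(LBINT v. norm (k x v * f x)) = norm (F x)" for x
      using s_pos[of x] by (simp add: abs_mult k_nonneg k_integral F_def)
    then show "integrable lborel (\<lambda>x. LBINT v. norm (case (x, v) of (x, v) \<Rightarrow> k x v * f x))"
      using F_int by simp
  qed (use k_int in auto)
  \<comment> \<open>For \<open>v > 0\<close> the expectation is the integral of \<open>f\<close>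
    against the normal density; otherwise both sides are 0.\<close>
  have inner: "(LBINT x. k x v * f x) = indicator {0<..} v *\<^sub>R (w v * (LINT \<omega>|M. f (\<beta> v \<omega>)))" for v
  proof (cases "v > 0")
    case True
    then show ?thesis
      using expect(2)[OF True] by (simp add: k_def mult.assoc)
  qed (simp add: k_def)
  have "(LBINT x. F x) = (LBINT x. LBINT v. k x v * f x)"
    by (simp add: k_integral F_def)
  also have "\<dots> = (LBINT v. LBINT x. k x v * f x)"
    by (rule lborel_pair.Fubini_integral[OF kf_int, symmetric])
  finally show ?thesis
    using int_f lborel_pair.integrable_snd[OF kf_int]
    unfolding LHS inner w_def set_integrable_def set_lebesgue_integral_def by simp
qed

end
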